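(* Every odd prime $p\in J$ is exceptional.
   Context: For odd $m\ge 3$ let $\mathbb{Z}_m=\mathbb{Z}/m\mathbb{Z}$. A Cayley subset of $\mathbb{Z}_m$ is a subset $S$ with $0\notin S$, $S=-S$, generating $\mathbb{Z}_m$. $X(S)$ is the Cayley graph on $\mathbb{Z}_m$ ($x\sim y$ iff $y-x\in S$), with non-trivial eigenvalues $\mu_j(S)=\sum_{a\in S}e^{2\pi i a j/m}$ ($1\le j\le m-1$) and $\mu(S)=\max_j|\mu_j(S)|$; it is Ramanujan if $\mu(S)\le 2\sqrt{|S|-1}$. The covalency is $l(S)=m-|S|$. $\hat{l}$ is the largest covalency value $l$ such that $X(S)$ is Ramanujan for every Cayley subset $S$ with $l(S)\le l$. Let $l_0=2\lfloor\sqrt{m}-\frac32\rfloor+1$; $m\ge 15$ is called exceptional if $\hat{l}=l_0+2$. $J=\{2n+1: 7\le n\le 14\}\cup\{k^2+5k+c: k\ge 4,\ c\in\{\pm1,\pm3,5\}\}\cup\{k^2+5k-5: k\ge 19\}$ (all elements of $J$ are $\ge 15$). *)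

theory Defs
  imports Complex_Main "HOL-Computational_Algebra.Primes" "HOL-Algebra.Elementary_Groups"
begin

definition cayley_subset :: "nat \<Rightarrow> int set \<Rightarrow> bool" where
  "cayley_subset m S \<longleftrightarrow>
     S \<subseteq> carrier (integer_mod_group m) \<and>
     \<one>\<^bsub>integer_mod_group m\<^esub> \<notin> S \<and>
     S = set_inv\<^bsub>integer_mod_group m\<^esub> S \<and>
     generate (integer_mod_group m) S = carrier (integer_mod_group m)"

definition cayley_adj :: "nat \<Rightarrow> int set \<Rightarrow> int \<Rightarrow> int \<Rightarrow> bool" where
  "cayley_adj m S x y \<longleftrightarrow> y \<otimes>\<^bsub>integer_mod_group m\<^esub> inv\<^bsub>integer_mod_group m\<^esub> x \<in> S"

definition eigval :: "nat \<Rightarrow> int set \<Rightarrow> nat \<Rightarrow> complex" where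
  "eigval m S j = (\<Sum>a\<in>S. exp (2 * of_real pi * \<i> * of_int a * of_nat j / of_nat m))"

definition max_eigval :: "nat \<Rightarrow> int set \<Rightarrow> real" where
  "max_eigval m S = Max ((\<lambda>j. cmod (eigval m S j)) ` {1..m - 1})"

definition ramanujan :: "nat \<Rightarrow> int set \<Rightarrow> bool" where
  "ramanujan m S \<longleftrightarrow> max_eigval m S \<le> 2 * sqrt (real (card S) - 1)"

definition covalency :: "nat \<Rightarrow> int set \<Rightarrow> nat" where
  "covalency m S = m - card S"

definition good_covalencies :: "nat \<Rightarrow> nat set" where
  "good_covalencies m =
     {l \<in> covalency m ` {S. cayley_subset m S}.
        \<forall>S. cayley_subset m S \<and> covalency m S \<le> l \<longrightarrow> ramanujan m S}"

definition l_hat :: "nat \<Rightarrow> nat" where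
  "l_hat m = Max (good_covalencies m)"

definition l_zero :: "nat \<Rightarrow> int" where
  "l_zero m = 2 * \<lfloor>sqrt (real m) - 3 / 2\<rfloor> + 1"

definition exceptional :: "nat \<Rightarrow> bool" where
  "exceptional m \<longleftrightarrow> odd m \<and> m \<ge> 15 \<and> int (l_hat m) = l_zero m + 2"

definition J :: "nat set" where
  "J = {2 * n + 1 | n. 7 \<le> n \<and> n \<le> 14}
     \<union> {m. \<exists>(k::nat) (c::int). k \<ge> 4 \<and> c \<in> {1, -1, 3, -3, 5} \<and> int m = int k ^ 2 + 5 * int k + c}
     \<union> {m. \<exists>k::nat. k \<ge> 19 \<and> int m = int k ^ 2 + 5 * int k - 5}"

text \<open>The characters of the group are eigenvectors of the adjacency operator of the Cayley graph,
  with eigenvalues \<^const>\<open>eigval\<close>; the index \<open>j = 0\<close> is the trivial one.\<close>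

lemma exp_char_mod:
  assumes "m > 0"
  shows "exp (2 * of_real pi * \<i> * of_int (a mod int m) * of_nat j / of_nat m)
       = exp (2 * of_real pi * \<i> * of_int a * of_nat j / of_nat m)"
proof -
  have "a = a mod int m + int m * (a div int m)" by simp
  then have "(of_int a :: complex) = of_int (a mod int m) + of_nat m * of_int (a div int m)"
    by (metis of_int_add of_int_mult of_int_of_nat_eq)
  then have "2 * of_real pi * \<i> * of_int a * of_nat j / of_nat m
      = 2 * of_real pi * \<i> * of_int (a mod int m) * of_nat j / of_nat m
        + 2 * of_real pi * \<i> * of_int (a div int m * int j)"
    using assms by (simp add: field_simps)
  moreover have "exp (2 * of_real pi * \<i> * of_int k) = 1" for k
    using cis_multiple_2pi[of "of_int k"] by (simp add: cis_conv_exp mult_ac)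
  ultimately show ?thesis by (simp only: exp_add mult_1_right)
qed

lemma cayley_adj_eigenvector:
  fixes m j :: nat
  assumes m: "m > 0" and S: "S \<subseteq> carrier (integer_mod_group m)"
    and x: "x \<in> carrier (integer_mod_group m)"
  defines "\<chi> \<equiv> \<lambda>y::int. exp (2 * of_real pi * \<i> * of_int y * of_nat j / of_nat m)"
  shows "(\<Sum>y | y \<in> carrier (integer_mod_group m) \<and> cayley_adj m S x y. \<chi> y) = eigval m S j * \<chi> x"
proof -
  have C: "carrier (integer_mod_group m) = {0..<int m}"
    using m by (simp add: carrier_integer_mod_group)
  have adj: "cayley_adj m S x y \<longleftrightarrow> (y - x) mod int m \<in> S" for y
    using x by (simp add: cayley_adj_def mod_add_right_eq)
  have add: "\<chi> ((a + x) mod int m) = \<chi> a * \<chi> x" for a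
    unfolding \<chi>_def exp_char_mod[OF m] exp_add[symmetric]
    by (simp add: field_simps add_divide_distrib)
  have "(\<Sum>y | y \<in> carrier (integer_mod_group m) \<and> cayley_adj m S x y. \<chi> y)
      = (\<Sum>a\<in>S. \<chi> ((a + x) mod int m))"
  proof (rule sum.reindex_bij_witness[of _ "\<lambda>a. (a + x) mod int m" "\<lambda>y. (y - x) mod int m"])
    fix a assume "a \<in> S"
    then have a: "a \<in> {0..<int m}" using S C by auto
    show "((a + x) mod int m - x) mod int m = a"
      using a by (simp add: mod_diff_left_eq)
    then show "(a + x) mod int m \<in> {y \<in> carrier (integer_mod_group m). cayley_adj m S x y}"
      using m \<open>a \<in> S\<close> by (simp add: C adj)
  qed (use m in \<open>auto simp: adj C mod_add_left_eq\<close>)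
  also have "\<dots> = (\<Sum>a\<in>S. \<chi> a) * \<chi> x"
    by (simp only: add sum_distrib_right)
  also have "(\<Sum>a\<in>S. \<chi> a) = eigval m S j"
    by (simp only: eigval_def \<chi>_def)
  finally show ?thesis .
qed

text \<open>The set whose maximum defines \<^const>\<open>l_hat\<close> is finite and contains \<open>1\<close>, the covalency of the
  complete graph.\<close>

lemma finite_good_covalencies: "finite (good_covalencies m)"
  by (rule finite_subset[of _ "{..m}"]) (auto simp: good_covalencies_def covalency_def)

lemma one_in_good_covalencies:
  assumes m: "m \<ge> 3"
  shows "1 \<in> good_covalencies m"
proof -
  let ?G = "integer_mod_group m"
  let ?S = "{1..<int m}"
  have C: "carrier ?G = {0..<int m}"
    using m by (simp add: carrier_integer_mod_group)
  have inv: "inv\<^bsub>?G\<^esub> a = int m - a" if "a \<in> ?S" for a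
    using that by (simp add: C zmod_zminus1_eq_if)
  have "?S = (\<lambda>a. int m - a) ` ?S"
  proof (intro equalityI subsetI)
    fix x assume "x \<in> ?S"
    then show "x \<in> (\<lambda>a. int m - a) ` ?S" by (intro image_eqI[of _ _ "int m - x"]) auto
  qed auto
  also have "\<dots> = set_inv\<^bsub>?G\<^esub> ?S"
    unfolding SET_INV_def UNION_singleton_eq_range by (rule image_cong) (simp_all only: inv)
  finally have sym: "?S = set_inv\<^bsub>?G\<^esub> ?S" .
  have "generate ?G ?S = carrier ?G"
  proof
    show "generate ?G ?S \<subseteq> carrier ?G"
      by (rule group.generate_incl) (auto simp: C)
    show "carrier ?G \<subseteq> generate ?G ?S"
    proof
      fix x assume "x \<in> carrier ?G"
      then consider "x = \<one>\<^bsub>?G\<^esub>" | "x \<in> ?S" by (force simp: C)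
      then show "x \<in> generate ?G ?S" by cases (blast intro: generate.intros)+
    qed
  qed
  then have cay: "cayley_subset m ?S"
    using sym by (auto simp: cayley_subset_def C)
  have cov: "covalency m ?S = 1"
    using m by (simp add: covalency_def)
  have uniq: "S = ?S" if "cayley_subset m S" "covalency m S \<le> 1" for S
  proof -
    have sub: "S \<subseteq> ?S"
    proof
      fix x assume "x \<in> S"
      then have "x \<in> {0..<int m}" "x \<noteq> 0"
        using that(1) by (auto simp: cayley_subset_def C)
      then show "x \<in> ?S" by auto
    qed
    moreover have "card ?S \<le> card S"
      using that(2) m by (simp add: covalency_def)
    ultimately show ?thesis
      by (meson card_seteq finite_atLeastLessThan_int)
  qed
  have eig: "eigval m ?S j = -1" if j: "j \<in> {1..m - 1}" for j
  proof -
    define z where "z = exp (2 * of_real pi * \<i> * of_nat j / of_nat m)"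
    have pw: "exp (2 * of_real pi * \<i> * of_int (int k) * of_nat j / of_nat m) = z ^ k" for k
      unfolding z_def exp_of_nat_mult[symmetric] by (simp add: field_simps)
    have "z ^ m = 1"
      using exp_char_mod[of m "int m" j] m unfolding pw by simp
    moreover have "z \<noteq> 1"
    proof
      assume "z = 1"
      then have "cis (2 * pi * (real j / real m)) = 1"
        unfolding z_def cis_conv_exp by (simp add: mult_ac)
      then have "cos (2 * pi * (real j / real m)) = 1"
        by (simp add: complex_eq_iff)
      then obtain k :: int where "2 * pi * (real j / real m) = of_int k * 2 * pi"
        using cos_one_2pi_int by auto
      then have "real j / real m = of_int k"
        using m by (simp add: field_simps)
      moreover have "0 < real j / real m" "real j / real m < 1"
        using j m by (auto simp: field_simps)
      ultimately have "0 < k" "k < 1" by simp_all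
      then show False by simp
    qed
    ultimately have "(\<Sum>k<m. z ^ k) = 0"
      by (simp add: geometric_sum)
    moreover have "{..<m} = insert 0 {1..<m}" using m by auto
    ultimately have "(\<Sum>k\<in>{1..<m}. z ^ k) = -1"
      by (simp add: eq_neg_iff_add_eq_0 add.commute)
    moreover have "eigval m ?S j = (\<Sum>k\<in>{1..<m}. z ^ k)"
      unfolding eigval_def
    proof (rule sum.reindex_bij_witness[of _ int nat])
      fix a assume "a \<in> ?S"
      then have "int (nat a) = a" by simp
      then show "z ^ nat a = exp (2 * of_real pi * \<i> * of_int a * of_nat j / of_nat m)"
        using pw[of "nat a"] by (simp only:)
    qed auto
    ultimately show ?thesis by simp
  qed
  have "max_eigval m ?S = Max ((\<lambda>_. 1) ` {1..m - 1})"
    unfolding max_eigval_def by (intro arg_cong[where f = Max] image_cong) (auto simp: eig)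
  also have "\<dots> = 1"
    using image_constant[of "1::nat" "{1..m - 1}" "1::real"] m by simp
  also have "1 \<le> 2 * sqrt (real (card ?S) - 1)"
  proof -
    have "1 \<le> sqrt (real (card ?S) - 1)" using m by auto
    then show ?thesis by linarith
  qed
  finally have "ramanujan m ?S" unfolding ramanujan_def .
  then have "\<forall>S. cayley_subset m S \<and> covalency m S \<le> 1 \<longrightarrow> ramanujan m S"
    using uniq by blast
  moreover have "1 \<in> covalency m ` {S. cayley_subset m S}"
    using cay cov by (metis imageI mem_Collect_eq)
  ultimately show ?thesis
    unfolding good_covalencies_def by blast
qed

end

theory Submission
  imports Defs "HOL-Analysis.Complex_Transcendental"
begin

text \<open>For \<open>j \<noteq> 0\<close> the eigenvalue of \<open>S\<close> is minus the character sum over the complement \<open>T\<close> of \<open>S\<close>, which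
  has \<open>l(S)\<close> elements. As \<open>p\<close> is prime, multiplication by \<open>j\<close> permutes the residues, so it suffices to
  bound \<open>\<Sum>\<^bsub>t\<in>T\<^esub> cos (2\<pi>t/p)\<close>. Among sets of \<open>l = 2r + 1\<close> residues this sum is largest for \<open>{-r, \<dots>, r}\<close>,
  where it is the Dirichlet kernel \<open>sin (l\<pi>/p) / sin (\<pi>/p)\<close>, and it is at least \<open>2 - l\<close> since \<open>0 \<in> T\<close>.
  Hence the largest good covalency is the odd \<open>l\<close> for which the kernel is at most \<open>2 sqrt (p - l - 1)\<close>
  while the reverse strict inequality holds for \<open>l + 2\<close>. For \<open>p = k\<^sup>2 + 5k + c\<close> one has \<open>l\<^sub>0 = 2k + 1\<close>;
  with \<open>l = 2k + 3\<close> the kernel is about \<open>l - 8\<pi>\<^sup>2/(3l)\<close> and the square root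
  \<open>sqrt (l\<^sup>2 - (25 - 4c))\<close> about \<open>l - (25 - 4c)/(2l)\<close>, so \<open>c \<ge> -5\<close> makes \<open>l\<close> good for large \<open>k\<close>, whereas for
  \<open>l + 2\<close> the square root drops by about \<open>2\<close> below the kernel. The primes \<open>17, 19, 23, 29\<close> have the same form
  with \<open>k = 2, 2, 3, 3\<close> and \<open>c = 3, 5, -1, 5\<close>.\<close>

section \<open>Estimates of sine quotients\<close>

text \<open>Maclaurin expansions with Lagrange remainder of orders 3 and 5; the sine in the
  remainder lies between -1 and 1.\<close>

lemma sin_taylor_bounds:
  fixes x :: real
  assumes "0 \<le> x"
  shows sin_ge_cubic: "x - x ^ 3 / 6 \<le> sin x"
    and sin_le_quintic: "sin x \<le> x - x ^ 3 / 6 + x ^ 5 / 120"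
proof -
  have "x - x ^ 3 / 6 \<le> sin x \<and> sin x \<le> x - x ^ 3 / 6 + x ^ 5 / 120"
  proof (cases "x = 0")
    case False
    with assms have x: "0 < x" by simp
    obtain t where t: "sin x = (\<Sum>m<3. sin_coeff m * x ^ m) + sin (t + 1/2 * real 3 * pi) / fact 3 * x ^ 3"
      using Maclaurin_sin_expansion3[of 3 x] x by auto
    obtain s where s: "sin x = (\<Sum>m<5. sin_coeff m * x ^ m) + sin (s + 1/2 * real 5 * pi) / fact 5 * x ^ 5"
      using Maclaurin_sin_expansion3[of 5 x] x by auto
    have "- 1 * x ^ 3 \<le> sin (t + 1/2 * real 3 * pi) * x ^ 3"
      using x by (intro mult_right_mono) auto
    moreover have "sin (s + 1/2 * real 5 * pi) * x ^ 5 \<le> 1 * x ^ 5"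
      using x by (intro mult_right_mono) auto
    moreover have sets: "{..<3::nat} = {0, 1, 2}" "{..<5::nat} = {0, 1, 2, 3, 4}" by auto
    ultimately show ?thesis
      using s t by (simp add: sin_coeff_def sets fact_numeral mult.commute)
  qed auto
  then show "x - x ^ 3 / 6 \<le> sin x" "sin x \<le> x - x ^ 3 / 6 + x ^ 5 / 120" by auto
qed

lemma pi_square_bounds: "9.8688 \<le> pi\<^sup>2" "pi\<^sup>2 \<le> 9.87"
proof -
  have "3.14149\<^sup>2 \<le> pi\<^sup>2" "pi\<^sup>2 \<le> 3.1416\<^sup>2"
    using pi_approx by (auto intro!: power_mono)
  then show "9.8688 \<le> pi\<^sup>2" "pi\<^sup>2 \<le> 9.87" by (auto simp: power2_eq_square)
qed

text \<open>The quotient \<open>sin (l\<pi>/m) / sin (\<pi>/m)\<close> is about \<open>l - \<pi>\<^sup>2 u\<^sup>2 / (6l)\<close> with \<open>u = l\<^sup>2 / m\<close>, and the square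
  root is about \<open>l - d / (2l)\<close>; \<open>l - g / l\<close> separates the two.\<close>

lemma sin_quotient_le_sqrt:
  fixes l m d g u l0 m0 :: real
  assumes l: "1 \<le> l0" "l0 \<le> l" and m: "0 < m0" "m0 \<le> m"
    and u: "0 \<le> u" "u * m \<le> l\<^sup>2" "l\<^sup>2 \<le> 4 * m"
    and g: "0 \<le> g" "g \<le> l0\<^sup>2" "g + 52 / m0 \<le> 1.6448 * u\<^sup>2 * (1 - 1 / l0\<^sup>2)"
    and d: "d \<le> 2 * g - g\<^sup>2 / l0\<^sup>2" and m1: "1 < m"
  shows "sin (l * (pi / m)) \<le> sin (pi / m) * sqrt (l\<^sup>2 - d)"
proof -
  define x where "x = pi / m"
  define y where "y = x\<^sup>2"
  have pos: "0 < l" "0 < m" "0 < x" using l m by (auto simp: x_def)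
  have ll: "l0\<^sup>2 \<le> l\<^sup>2" "1 \<le> l0\<^sup>2" using l by (auto intro: power_mono)
  have y: "y = pi\<^sup>2 / m\<^sup>2" by (simp add: y_def x_def power_divide)
  define v where "v = l\<^sup>2 / m"
  have v: "u \<le> v" "v \<le> 4" using u pos by (auto simp: v_def field_simps)
  have inv_l: "1 / l\<^sup>2 \<le> 1 / l0\<^sup>2" using ll by (intro frac_le) auto
  have inv_l0: "1 / l0\<^sup>2 \<le> 1" using ll by (simp add: divide_le_eq)
  have inv_m: "52 / m \<le> 52 / m0" using m by (intro frac_le) auto
  have first: "1.6448 * u\<^sup>2 * (1 - 1 / l0\<^sup>2) \<le> pi\<^sup>2 / 6 * v\<^sup>2 * (1 - 1 / l\<^sup>2)"
    using pi_square_bounds v u inv_l inv_l0 by (intro mult_mono power_mono) auto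
  \<comment> \<open>The quintic Taylor term costs at most \<open>52 / m\<close>, since 9.87^2 * 4^3
    / 120 < 52. Likewise 1.6448 in \<open>first\<close> is 9.8688 / 6.\<close>
  have "(pi\<^sup>2)\<^sup>2 * v ^ 3 \<le> 9.87\<^sup>2 * 4 ^ 3"
    using pi_square_bounds v u by (intro mult_mono power_mono) auto
  then have "(pi\<^sup>2)\<^sup>2 * v ^ 3 / 120 \<le> 52" by (simp add: power2_eq_square)
  then have second: "(pi\<^sup>2)\<^sup>2 * v ^ 3 / 120 / m \<le> 52 / m"
    using pos by (intro divide_right_mono) auto
  have "g \<le> pi\<^sup>2 / 6 * v\<^sup>2 * (1 - 1 / l\<^sup>2) - (pi\<^sup>2)\<^sup>2 * v ^ 3 / 120 / m"
    using first second g(3) inv_m by linarith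
  also have "\<dots> = y * l\<^sup>2 * (l\<^sup>2 - 1) / 6 - y\<^sup>2 * l ^ 6 / 120"
    using pos by (simp add: y v_def field_simps eval_nat_numeral)
  finally have G: "g \<le> y * l\<^sup>2 * (l\<^sup>2 - 1) / 6 - y\<^sup>2 * l ^ 6 / 120" .
  have "g\<^sup>2 / l\<^sup>2 \<le> g\<^sup>2 / l0\<^sup>2" using ll by (intro frac_le) auto
  then have "(l - g / l)\<^sup>2 \<le> l\<^sup>2 - d"
    using d pos by (simp add: power2_diff power_divide)
  then have R: "l - g / l \<le> sqrt (l\<^sup>2 - d)" by (rule real_le_rsqrt)
  have "g \<le> l * l" using g ll by (simp add: power2_eq_square)
  then have gl: "0 \<le> l - g / l" using pos by (simp add: field_simps)
  have gy: "0 \<le> g * y" using g by (simp add: y_def)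
  \<comment> \<open>Up to the factor \<open>x / l\<close>, \<open>key\<close> compares the quintic
    upper bound of \<open>sin (l * x)\<close> with the cubic lower bound of \<open>sin x\<close>
    times \<open>l - g / l\<close>.\<close>
  have "(1 - y / 6) * (l\<^sup>2 - g) = l\<^sup>2 - g - y * l\<^sup>2 / 6 + g * y / 6"
    by (simp add: field_simps)
  moreover have "y * l\<^sup>2 * (l\<^sup>2 - 1) / 6 = y * l ^ 4 / 6 - y * l\<^sup>2 / 6"
    by (simp add: field_simps eval_nat_numeral)
  ultimately have key: "l\<^sup>2 - y * l ^ 4 / 6 + y\<^sup>2 * l ^ 6 / 120 \<le> (1 - y / 6) * (l\<^sup>2 - g)"
    using G gy by linarith
  have "sin (l * x) \<le> l * x - (l * x) ^ 3 / 6 + (l * x) ^ 5 / 120"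
    using pos by (intro sin_le_quintic) auto
  also have "\<dots> = x / l * (l\<^sup>2 - y * l ^ 4 / 6 + y\<^sup>2 * l ^ 6 / 120)"
    using pos by (simp add: y_def field_simps eval_nat_numeral)
  also have "\<dots> \<le> x / l * ((1 - y / 6) * (l\<^sup>2 - g))"
    using key pos by (intro mult_left_mono) auto
  also have "\<dots> = (x - x ^ 3 / 6) * (l - g / l)"
    using pos by (simp add: y_def field_simps eval_nat_numeral)
  also have "\<dots> \<le> sin x * sqrt (l\<^sup>2 - d)"
  proof (rule mult_mono)
    show "0 \<le> sin x" using m1 by (auto simp: x_def intro!: sin_ge_zero simp: field_simps)
  qed (use pos R gl in \<open>auto intro: sin_ge_cubic\<close>)
  finally show ?thesis by (simp add: x_def)
qed

text \<open>Bounds \<open>sin x\<close> by x on the left and uses the cubic bound on the right,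
  where x = pi / m; \<open>gap\<close> makes the cubic loss \<open>x^2 * l^3 / 6\<close> smaller
  than \<open>2 + h / l\<close>.\<close>

lemma sin_quotient_gt:
  fixes l m h R :: real
  assumes pos: "0 < l" "1 < m" "0 \<le> R" and R: "R \<le> l - 2 - h / l"
    and gap: "9.87 * l ^ 4 < 6 * m\<^sup>2 * (2 * l + h)"
  shows "sin (pi / m) * R < sin (l * (pi / m))"
proof -
  define x where "x = pi / m"
  have x: "0 < x" using pos by (simp add: x_def)
  have "pi\<^sup>2 * l ^ 4 \<le> 9.87 * l ^ 4" using pi_square_bounds by (intro mult_right_mono) auto
  with gap have "pi\<^sup>2 * l ^ 4 < 6 * m\<^sup>2 * (2 * l + h)" by linarith
  then have "x\<^sup>2 * l ^ 4 / 6 < 2 * l + h"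
    using pos by (simp add: x_def power_divide field_simps)
  then have *: "l - 2 - h / l < l - x\<^sup>2 * l ^ 3 / 6"
    using pos by (simp add: field_simps eval_nat_numeral)
  have "sin x * R \<le> x * (l - 2 - h / l)"
    using x pos R by (intro mult_mono sin_x_le_x) auto
  also have "\<dots> < x * (l - x\<^sup>2 * l ^ 3 / 6)"
    using * x by simp
  also have "\<dots> = l * x - (l * x) ^ 3 / 6"
    by (simp add: algebra_simps eval_nat_numeral)
  also have "\<dots> \<le> sin (l * x)"
    using pos x by (intro sin_ge_cubic) auto
  finally show ?thesis by (simp add: x_def)
qed

section \<open>Character sums over subsets\<close>

text \<open>The real part of \<open>eigval m S j\<close>, and all of it when S is symmetric.\<close>

definition cos_sum :: "nat \<Rightarrow> int set \<Rightarrow> nat \<Rightarrow> real" where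
  "cos_sum m S j = (\<Sum>a\<in>S. cos (2 * pi * of_int a * real j / real m))"

lemma char_eq_cis:
  "exp (2 * of_real pi * \<i> * of_int a * of_nat j / of_nat m) = cis (2 * pi * of_int a * real j / real m)"
  by (simp add: cis_conv_exp mult_ac)

lemma
  assumes "m > 0"
  shows cos_char_mod: "cos (2 * pi * of_int (a mod int m) * real j / real m) = cos (2 * pi * of_int a * real j / real m)"
    and sin_char_mod: "sin (2 * pi * of_int (a mod int m) * real j / real m) = sin (2 * pi * of_int a * real j / real m)"
  using exp_char_mod[OF assms, of a j] unfolding char_eq_cis by (simp_all add: complex_eq_iff)

text \<open>Negation permutes S, so the sum of the sines equals its own negative.\<close>

lemma eigval_eq_cos_sum:
  assumes m: "m > 0" and S: "S \<subseteq> {0..<int m}" "\<And>a. a \<in> S \<Longrightarrow> (- a) mod int m \<in> S"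
  shows "eigval m S j = of_real (cos_sum m S j)"
proof -
  let ?s = "\<lambda>a. sin (2 * pi * of_int a * real j / real m)"
  have "(\<Sum>a\<in>S. ?s a) = (\<Sum>a\<in>S. - ?s a)"
  proof (rule sum.reindex_bij_witness[of _ "\<lambda>a. (- a) mod int m" "\<lambda>a. (- a) mod int m"])
    fix a assume a: "a \<in> S"
    then have "0 \<le> a" "a < int m" using S by auto
    then show "- (- a mod int m) mod int m = a" by (simp add: mod_minus_eq)
    then show "- (- a mod int m) mod int m = a" .
    show "- ?s (- a mod int m) = ?s a" by (simp only: sin_char_mod[OF m]) simp
  qed (use S in auto)
  then have "(\<Sum>a\<in>S. ?s a) = 0" by (simp add: sum_negf)
  then show ?thesis
    unfolding eigval_def char_eq_cis cos_sum_def
    by (simp add: complex_eq_iff)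
qed

text \<open>The residues -r, ..., r modulo m, the negative ones represented by m - r, ..., m -
  1.\<close>

definition central_set :: "nat \<Rightarrow> nat \<Rightarrow> int set" where
  "central_set m r = {a. 0 \<le> a \<and> a < int m \<and> (a \<le> int r \<or> int m - int r \<le> a)}"

lemma central_set_subset: "central_set m r \<subseteq> {0..<int m}"
  by (auto simp: central_set_def)

lemma finite_central_set [simp]: "finite (central_set m r)"
  using finite_subset[OF central_set_subset] by simp

lemma central_set_0: "m > 0 \<Longrightarrow> central_set m 0 = {0}"
  by (auto simp: central_set_def)

lemma central_set_Suc:
  assumes "2 * r + 3 \<le> m"
  shows "central_set m (Suc r) = insert (int r + 1) (insert (int m - int r - 1) (central_set m r))"
    "int r + 1 \<noteq> int m - int r - 1"
    "int r + 1 \<notin> central_set m r" "int m - int r - 1 \<notin> central_set m r"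
  using assms by (auto simp: central_set_def)

lemma card_central_set: "2 * r + 1 \<le> m \<Longrightarrow> card (central_set m r) = 2 * r + 1"
proof (induction r)
  case 0
  then show ?case by (simp add: central_set_0)
next
  case (Suc r)
  then show ?case using central_set_Suc[of r m] by simp
qed

text \<open>Closed form of the Dirichlet kernel, multiplied out to avoid dividing by the
  sine.\<close>

lemma cos_sum_central_set:
  assumes "2 * r + 1 \<le> m"
  shows "cos_sum m (central_set m r) j * sin (pi * real j / real m) = sin (real (2 * r + 1) * (pi * real j / real m))"
  using assms
proof (induction r)
  case 0
  then show ?case by (simp add: cos_sum_def central_set_0)
next
  case (Suc r)
  let ?x = "pi * real j / real m"
  have m: "m > 0" using Suc.prems by simp
  \<comment> \<open>The second new element represents -(r + 1), so both new elements contribute the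
    same cosine.\<close>
  have mod: "(int m - int r - 1) mod int m = (- (int r + 1)) mod int m"
    by (simp add: mod_eq_dvd_iff)
  have "cos (2 * pi * of_int (int m - int r - 1) * real j / real m)
      = cos (2 * pi * of_int ((- (int r + 1)) mod int m) * real j / real m)"
    using cos_char_mod[OF m, of "int m - int r - 1" j] mod by simp
  also have "\<dots> = cos (2 * pi * of_int (- (int r + 1)) * real j / real m)"
    by (rule cos_char_mod[OF m])
  also have "2 * pi * of_int (- (int r + 1)) * real j / real m = - (2 * (real r + 1) * ?x)"
    using m by (simp add: field_simps)
  finally have refl: "cos (2 * pi * of_int (int m - int r - 1) * real j / real m) = cos (2 * (real r + 1) * ?x)"
    by simp
  have "2 * pi * of_int (int r + 1) * real j / real m = 2 * (real r + 1) * ?x"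
    by (simp add: field_simps)
  then have arg: "cos (2 * pi * of_int (int r + 1) * real j / real m) = cos (2 * (real r + 1) * ?x)"
    by (simp only:)
  have "cos_sum m (central_set m (Suc r)) j
      = cos (2 * pi * of_int (int r + 1) * real j / real m)
        + (cos (2 * pi * of_int (int m - int r - 1) * real j / real m) + cos_sum m (central_set m r) j)"
    using central_set_Suc[of r m] Suc.prems by (simp add: cos_sum_def)
  then have "cos_sum m (central_set m (Suc r)) j * sin ?x
      = 2 * cos (2 * (real r + 1) * ?x) * sin ?x + sin (real (2 * r + 1) * ?x)"
    unfolding refl arg using Suc by (simp add: distrib_right)
  \<comment> \<open>Product-to-sum makes the induction telescope: the subtracted sine is the one for
    r.\<close>
  also have "2 * cos (2 * (real r + 1) * ?x) * sin ?x
      = sin (2 * (real r + 1) * ?x + ?x) - sin (2 * (real r + 1) * ?x - ?x)"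
    by (simp add: mult.assoc cos_times_sin)
  finally show ?case by (simp add: algebra_simps)
qed

lemma sin_char_pos:
  assumes "j \<in> {1..m - 1}"
  shows "0 < sin (pi * real j / real m)"
proof (rule sin_gt_zero)
  have "0 < real j" "real j < real m" using assms by auto
  then show "0 < pi * real j / real m" "pi * real j / real m < pi"
    by (simp_all add: field_simps)
qed

text \<open>For m = 2r + 1 the central set is everything, and the numerator of the kernel is sin (j
  pi) = 0.\<close>

lemma cos_sum_full:
  assumes "odd m" "j \<in> {1..m - 1}"
  shows "cos_sum m {0..<int m} j = 0"
proof -
  obtain r where r: "m = 2 * r + 1" using assms(1) by (elim oddE)
  have full: "central_set m r = {0..<int m}" by (auto simp: central_set_def r)
  have "real m * (pi * real j / real m) = of_int (int j) * pi" using r by simp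
  then have "sin (real m * (pi * real j / real m)) = 0"
    by (metis sin_npi_int mult.commute)
  then show ?thesis
    using cos_sum_central_set[of r m j] sin_char_pos[OF assms(2)] full r by simp
qed

lemma cos_sum_Compl:
  assumes "odd m" "j \<in> {1..m - 1}" "S \<subseteq> {0..<int m}"
  shows "cos_sum m S j = - cos_sum m ({0..<int m} - S) j"
  using cos_sum_full[OF assms(1,2)] assms(3) unfolding cos_sum_def
  by (subst sum_diff) auto

text \<open>The value of the cosine at \<open>2\<pi>r/m\<close> separates the central set from the rest.\<close>

lemma cos_sum_le_central:
  assumes m: "m > 0" and U: "U \<subseteq> {0..<int m}" "card U \<le> 2 * r + 1" and r: "4 * r \<le> m"
  shows "cos_sum m U 1 \<le> cos_sum m (central_set m r) 1"
proof -
  define f where "f a = cos (2 * pi * of_int a / real m)" for a :: int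
  define c where "c = f (int r)"
  have finU: "finite U" using U finite_subset by blast
  have mono: "f b \<le> f a" if "0 \<le> a" "a \<le> b" "2 * b \<le> int m" for a b
    unfolding f_def
  proof (rule cos_monotone_0_pi_le)
    have "real_of_int (2 * b) \<le> real m" using that(3) by linarith
    then show "2 * pi * real_of_int b / real m \<le> pi" using m by (simp add: field_simps)
  qed (use that m in \<open>auto simp: field_simps\<close>)
  have refl: "f (int m - a) = f a" for a
  proof -
    have "2 * pi * of_int (int m - a) / real m = 2 * pi - 2 * pi * of_int a / real m"
      using m by (simp add: field_simps)
    then show ?thesis by (simp add: f_def cos_diff)
  qed
  \<comment> \<open>\<open>4 * r \<le> m\<close> keeps the angle of c within a quarter turn;
    \<open>0 \<le> c\<close> lets U have fewer than 2r + 1 elements.\<close>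
  have c0: "0 \<le> c" unfolding c_def f_def
  proof (rule cos_ge_zero)
    have "4 * real r \<le> real m" using r by linarith
    then show "2 * pi * of_int (int r) / real m \<le> pi / 2" using m by (simp add: field_simps)
    show "- (pi / 2) \<le> 2 * pi * of_int (int r) / real m"
      by (rule order_trans[of _ 0]) auto
  qed
  have inside: "c \<le> f a" if "a \<in> central_set m r" for a
  proof (cases "a \<le> int r")
    case True
    then show ?thesis using that r by (auto simp: c_def central_set_def intro: mono)
  next
    case False
    then have "c \<le> f (int m - a)" using that r by (auto simp: c_def central_set_def intro: mono)
    then show ?thesis by (simp add: refl)
  qed
  have outside: "f a \<le> c" if "a \<in> {0..<int m} - central_set m r" for a
  proof (cases "2 * a \<le> int m")
    case True
    then show ?thesis using that r by (auto simp: c_def central_set_def intro: mono)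
  next
    case False
    then have "f (int m - a) \<le> c" using that r by (auto simp: c_def central_set_def intro: mono)
    then show ?thesis by (simp add: refl)
  qed
  \<comment> \<open>With c subtracted, terms outside the central set are nonpositive and terms
    inside nonnegative: U is first cut down to the intersection, which is then enlarged.\<close>
  have "(\<Sum>a\<in>U. f a - c) \<le> (\<Sum>a\<in>U \<inter> central_set m r. f a - c)"
  proof -
    have "(\<Sum>a\<in>U. f a - c) = (\<Sum>a\<in>U \<inter> central_set m r. f a - c) + (\<Sum>a\<in>U - central_set m r. f a - c)"
      using finU by (rule sum.Int_Diff)
    moreover have "(\<Sum>a\<in>U - central_set m r. f a - c) \<le> 0"
      using outside U by (intro sum_nonpos) auto
    ultimately show ?thesis by simp
  qed
  also have "\<dots> \<le> (\<Sum>a\<in>central_set m r. f a - c)"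
    using inside by (intro sum_mono2) auto
  finally have "sum f U - real (card U) * c \<le> sum f (central_set m r) - real (2 * r + 1) * c"
    using card_central_set[of r m] r m by (simp add: sum_subtractf)
  moreover have "real (card U) * c \<le> real (2 * r + 1) * c"
    using c0 U by (intro mult_right_mono) auto
  ultimately show ?thesis by (simp add: f_def cos_sum_def)
qed

lemma inj_on_mult_mod_prime:
  assumes p: "prime p" and j: "j \<in> {1..p - 1}"
  shows "inj_on (\<lambda>a. a * int j mod int p) {0..<int p}"
proof
  fix a b assume ab: "a \<in> {0..<int p}" "b \<in> {0..<int p}" "a * int j mod int p = b * int j mod int p"
  then have "int p dvd (a - b) * int j"
    by (metis mod_eq_dvd_iff left_diff_distrib)
  moreover have "\<not> int p dvd int j"
    using j by (auto dest: dvd_imp_le)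
  moreover have "prime (int p)" using p by simp
  ultimately have "int p dvd a - b" using prime_dvd_mult_iff by blast
  then have "a mod int p = b mod int p" by (simp add: mod_eq_dvd_iff)
  then show "a = b" using ab by simp
qed

text \<open>Replacing T by its image under multiplication by j turns frequency j into frequency 1
  and keeps the cardinality.\<close>

lemma cos_sum_le_sin_quotient:
  assumes p: "prime p" and j: "j \<in> {1..p - 1}"
    and T: "T \<subseteq> {0..<int p}" "card T \<le> 2 * r + 1" and r: "4 * r \<le> p"
  shows "cos_sum p T j * sin (pi / real p) \<le> sin (real (2 * r + 1) * (pi / real p))"
proof -
  have p2: "p \<ge> 2" using p by (rule prime_ge_2_nat)
  let ?f = "\<lambda>a. a * int j mod int p"
  have inj: "inj_on ?f T" using inj_on_mult_mod_prime[OF p j] T(1) by (rule inj_on_subset)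
  have "cos_sum p (?f ` T) 1 = cos_sum p T j"
    unfolding cos_sum_def sum.reindex[OF inj] o_def
    using p2 by (subst cos_char_mod) (auto simp: mult.assoc)
  moreover have "cos_sum p (?f ` T) 1 \<le> cos_sum p (central_set p r) 1"
    using p2 T r card_image[OF inj] by (intro cos_sum_le_central) auto
  ultimately have "cos_sum p T j * sin (pi / real p) \<le> cos_sum p (central_set p r) 1 * sin (pi / real p)"
    using sin_char_pos[of 1 p] p2 by (intro mult_right_mono) auto
  then show ?thesis
    using cos_sum_central_set[of r p 1] r p2 by simp
qed

text \<open>The element 0 contributes 1, every other element at least -1.\<close>

lemma cos_sum_ge:
  assumes "finite T" "0 \<in> T"
  shows "2 - real (card T) \<le> cos_sum m T j"
proof -
  have "(\<Sum>a\<in>T - {0}. - 1) \<le> (\<Sum>a\<in>T - {0}. cos (2 * pi * of_int a * real j / real m))"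
    by (intro sum_mono) simp
  moreover have "cos_sum m T j = 1 + (\<Sum>a\<in>T - {0}. cos (2 * pi * of_int a * real j / real m))"
    unfolding cos_sum_def by (subst sum.remove[OF assms]) simp
  moreover have "card T \<ge> 1" using assms by (auto simp: Suc_le_eq card_gt_0_iff)
  ultimately show ?thesis using assms by (simp add: of_nat_diff)
qed

section \<open>Cayley subsets of prime order groups\<close>

text \<open>By Lagrange the order of the generated subgroup divides p, and it is not 1 because 0 and
  a are distinct members.\<close>

lemma generate_integer_mod_group_prime:
  assumes p: "prime p" and S: "S \<subseteq> {0..<int p}" and a: "a \<in> S" "a \<noteq> 0"
  shows "generate (integer_mod_group p) S = carrier (integer_mod_group p)"
proof -
  let ?G = "integer_mod_group p"
  interpret G: group ?G by simp
  have C: "carrier ?G = {0..<int p}"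
    using prime_gt_0_nat[OF p] by (simp add: carrier_integer_mod_group)
  let ?H = "generate ?G S"
  have sub: "subgroup ?H ?G" using S by (intro G.generate_is_subgroup) (simp add: C)
  have incl: "?H \<subseteq> carrier ?G" using sub by (rule subgroup.subset)
  then have fin: "finite ?H" by (rule finite_subset) (simp add: C)
  have "card ?H dvd p"
    using G.lagrange[OF sub] by (metis C order_def card_atLeastLessThan_int diff_zero dvd_triv_right nat_int)
  moreover have "card ?H \<noteq> 1"
  proof -
    have "{0, a} \<subseteq> ?H" using a by (auto intro: generate.incl generate.one[of ?G S, simplified])
    then have "card {0, a} \<le> card ?H" using fin by (intro card_mono)
    then show ?thesis using a by simp
  qed
  ultimately have "card ?H = p" using p prime_nat_iff by blast
  then show ?thesis using incl by (intro card_subset_eq) (simp_all add: C)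
qed

lemma cayley_subset_props:
  assumes "cayley_subset m S" "m > 0"
  shows "S \<subseteq> {0..<int m}" "0 \<notin> S" "\<And>a. a \<in> S \<Longrightarrow> (- a) mod int m \<in> S"
proof -
  let ?G = "integer_mod_group m"
  have C: "carrier ?G = {0..<int m}" using assms(2) by (simp add: carrier_integer_mod_group)
  show sub: "S \<subseteq> {0..<int m}" and "0 \<notin> S" using assms by (auto simp: cayley_subset_def C)
  fix a assume a: "a \<in> S"
  then have "inv\<^bsub>?G\<^esub> a \<in> set_inv\<^bsub>?G\<^esub> S" by (auto simp: SET_INV_def)
  moreover have "inv\<^bsub>?G\<^esub> a = (- a) mod int m" using a sub by (intro inv_integer_mod_group) (auto simp: C)
  ultimately show "(- a) mod int m \<in> S" using assms(1) by (simp add: cayley_subset_def)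
qed

text \<open>These complements show that the covalency 2r + 1 is attained, and they are the extremal
  sets that refute larger covalencies.\<close>

lemma cayley_subset_central_Compl:
  assumes p: "prime p" and r: "2 * r + 3 \<le> p"
  shows "cayley_subset p ({0..<int p} - central_set p r)"
    and "covalency p ({0..<int p} - central_set p r) = 2 * r + 1"
proof -
  let ?G = "integer_mod_group p" and ?S = "{0..<int p} - central_set p r"
  have p0: "p > 0" using p by (rule prime_gt_0_nat)
  have C: "carrier ?G = {0..<int p}" using p0 by (simp add: carrier_integer_mod_group)
  have S: "?S = {int r + 1..int p - int r - 1}" using r by (auto simp: central_set_def)
  have "inv\<^bsub>?G\<^esub> a = int p - a" if "a \<in> ?S" for a
    using that r by (subst inv_integer_mod_group) (auto simp: C S zmod_zminus1_eq_if)
  then have "set_inv\<^bsub>?G\<^esub> ?S = (\<lambda>a. int p - a) ` ?S"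
    by (auto simp: SET_INV_def)
  also have "\<dots> = ?S"
    unfolding S by (auto simp: image_iff intro!: bexI[of _ "int p - _"])
  finally have "set_inv\<^bsub>?G\<^esub> ?S = ?S" .
  moreover have "generate ?G ?S = carrier ?G"
    using p r by (intro generate_integer_mod_group_prime[of _ _ "int r + 1"]) (auto simp: S)
  ultimately show "cayley_subset p ?S"
    using p0 by (auto simp: cayley_subset_def C central_set_def)
  have "card ?S = p - (2 * r + 1)"
    using card_Diff_subset[of "central_set p r" "{0..<int p}"] central_set_subset[of p r]
      card_central_set[of r p] r by simp
  then show "covalency p ?S = 2 * r + 1" using r by (simp add: covalency_def)
qed

text \<open>For odd m the involution a -> m - a on S has no fixed point, so S has even size.\<close>

lemma odd_covalency:
  assumes S: "cayley_subset m S" and m: "odd m"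
  shows "odd (covalency m S)"
proof -
  have m0: "m > 0" using m odd_pos by blast
  note S' = cayley_subset_props[OF S m0]
  have fin: "finite S" using S'(1) finite_subset by blast
  have refl: "int m - a \<in> S" if "a \<in> S" for a
  proof -
    have "a \<noteq> 0" "a \<in> {0..<int m}" using that S'(1,2) by auto
    then have "0 < a" "a < int m" by auto
    then show ?thesis using S'(3)[OF that] by (simp add: zmod_zminus1_eq_if)
  qed
  let ?A = "{a \<in> S. 2 * a < int m}" and ?B = "{a \<in> S. int m < 2 * a}"
  have "bij_betw (\<lambda>a. int m - a) ?A ?B"
    by (rule bij_betw_byWitness[where f' = "\<lambda>a. int m - a"]) (auto intro: refl)
  then have "card ?A = card ?B" by (rule bij_betw_same_card)
  moreover have "2 * a \<noteq> int m" for a using m by presburger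
  then have "S = ?A \<union> ?B" using linorder_neqE by blast
  then have "card S = card ?A + card ?B" using fin by (subst card_Un_disjoint[symmetric]) auto
  ultimately have "even (card S)" by simp
  moreover have "card S \<le> card {0..<int m}" by (rule card_mono) (use S'(1) in auto)
  ultimately show ?thesis using m by (simp add: covalency_def)
qed

text \<open>The bounds for complements of size 2r + 1 also hold for smaller ones, while the
  Ramanujan bound grows with S; hence only the extreme covalency has to be checked.\<close>

lemma ramanujan_if_covalency_le:
  assumes p: "prime p" "odd p" and S: "cayley_subset p S" "covalency p S \<le> 2 * r + 1"
    and r: "4 * r \<le> p" "2 * r + 3 \<le> p"
    and upper: "sin (real (2 * r + 1) * (pi / p)) \<le> sin (pi / p) * (2 * sqrt (real p - real (2 * r + 1) - 1))"
    and lower: "real (2 * r + 1) - 2 \<le> 2 * sqrt (real p - real (2 * r + 1) - 1)"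
  shows "ramanujan p S"
proof -
  let ?R = "2 * sqrt (real p - real (2 * r + 1) - 1)"
  have p2: "p \<ge> 2" using p prime_ge_2_nat by blast
  then have p0: "p > 0" by simp
  note S' = cayley_subset_props[OF S(1) p0]
  define T where "T = {0..<int p} - S"
  have finS: "finite S" using S'(1) finite_subset by blast
  have "card S \<le> card {0..<int p}" by (rule card_mono) (use S'(1) in auto)
  then have cS: "card S \<le> p" by simp
  have cT: "card T = p - card S" using S'(1) finS by (simp add: T_def card_Diff_subset)
  have cT': "card T \<le> 2 * r + 1" using S(2) cT by (simp add: covalency_def)
  have bound: "?R \<le> 2 * sqrt (real (card S) - 1)" using cT cT' cS by simp
  have "cmod (eigval p S j) \<le> ?R" if j: "j \<in> {1..p - 1}" for j
  proof -
    have "0 < sin (pi / p)" using sin_char_pos[of 1 p] p2 by simp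
    moreover have "cos_sum p T j * sin (pi / p) \<le> sin (real (2 * r + 1) * (pi / p))"
      using p j cT' r by (intro cos_sum_le_sin_quotient) (auto simp: T_def)
    then have "cos_sum p T j * sin (pi / p) \<le> ?R * sin (pi / p)"
      using upper by (simp add: mult.commute)
    ultimately have "cos_sum p T j \<le> ?R" by simp
    moreover have "2 - real (card T) \<le> cos_sum p T j"
      using S' p0 by (intro cos_sum_ge) (auto simp: T_def)
    then have "- ?R \<le> cos_sum p T j" using lower cT' by linarith
    moreover have "cos_sum p S j = - cos_sum p T j"
      unfolding T_def using p(2) j S'(1) by (rule cos_sum_Compl)
    ultimately have "\<bar>cos_sum p S j\<bar> \<le> ?R" by simp
    then show ?thesis using eigval_eq_cos_sum[OF p0 S'(1) S'(3)] by simp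
  qed
  then have "cmod (eigval p S j) \<le> 2 * sqrt (real (card S) - 1)" if "j \<in> {1..p - 1}" for j
    using that bound order_trans by blast
  then show ?thesis
    unfolding ramanujan_def max_eigval_def using p2 by (intro Max.boundedI) auto
qed

text \<open>The eigenvalue with j = 1, whose modulus is at least the kernel, already exceeds the
  bound.\<close>

lemma not_ramanujan_central_Compl:
  assumes p: "prime p" "odd p" and r: "2 * r + 3 \<le> p"
    and gt: "sin (pi / p) * (2 * sqrt (real p - real (2 * r + 1) - 1)) < sin (real (2 * r + 1) * (pi / p))"
  shows "\<not> ramanujan p ({0..<int p} - central_set p r)"
proof
  let ?S = "{0..<int p} - central_set p r" and ?R = "2 * sqrt (real p - real (2 * r + 1) - 1)"
  have p2: "p \<ge> 2" using p prime_ge_2_nat by blast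
  then have p0: "p > 0" by simp
  assume ram: "ramanujan p ?S"
  have "cmod (eigval p ?S 1) \<le> max_eigval p ?S"
    unfolding max_eigval_def using p2 by (intro Max_ge) auto
  also have "\<dots> \<le> ?R"
    using ram card_Diff_subset[of "central_set p r" "{0..<int p}"] central_set_subset[of p r]
      card_central_set[of r p] r by (simp add: ramanujan_def of_nat_diff)
  finally have "cmod (eigval p ?S 1) \<le> ?R" .
  moreover have "eigval p ?S 1 = of_real (cos_sum p ?S 1)"
    using cayley_subset_props[OF cayley_subset_central_Compl(1)[OF p(1) r] p0]
    by (intro eigval_eq_cos_sum p0)
  moreover have "cos_sum p ?S 1 = - cos_sum p (central_set p r) 1"
    using cos_sum_Compl[of p 1 "central_set p r"] p p2 central_set_subset[of p r] by simp
  ultimately have "cos_sum p (central_set p r) 1 \<le> ?R" by simp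
  moreover have "0 \<le> sin (pi / p)" using sin_char_pos[of 1 p] p2 by simp
  ultimately have "cos_sum p (central_set p r) 1 * sin (pi / p) \<le> ?R * sin (pi / p)"
    by (intro mult_right_mono)
  then show False using gt cos_sum_central_set[of r p 1] r by (simp add: mult.commute)
qed

text \<open>One non-Ramanujan set of covalency 2r + 3 excludes every l from there on, and parity
  excludes 2r + 2.\<close>

lemma l_hat_eqI:
  assumes p: "prime p" "odd p" and r: "4 * r \<le> p" "2 * r + 5 \<le> p"
    and upper: "sin (real (2 * r + 1) * (pi / p)) \<le> sin (pi / p) * (2 * sqrt (real p - real (2 * r + 1) - 1))"
    and lower: "real (2 * r + 1) - 2 \<le> 2 * sqrt (real p - real (2 * r + 1) - 1)"
    and gt: "sin (pi / p) * (2 * sqrt (real p - real (2 * r + 3) - 1)) < sin (real (2 * r + 3) * (pi / p))"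
  shows "l_hat p = 2 * r + 1"
  unfolding l_hat_def
proof (rule Max_eqI[OF finite_good_covalencies])
  have "ramanujan p S" if "cayley_subset p S" "covalency p S \<le> 2 * r + 1" for S
    using ramanujan_if_covalency_le[OF p that r(1) _ upper lower] r by simp
  then show "2 * r + 1 \<in> good_covalencies p"
    using cayley_subset_central_Compl[OF p(1), of r] r
    by (auto simp: good_covalencies_def intro!: image_eqI[of _ _ "{0..<int p} - central_set p r"])
  fix l assume l: "l \<in> good_covalencies p"
  show "l \<le> 2 * r + 1"
  proof (rule ccontr)
    assume "\<not> l \<le> 2 * r + 1"
    let ?S = "{0..<int p} - central_set p (Suc r)"
    have not_ram: "\<not> ramanujan p ?S"
      using gt r by (intro not_ramanujan_central_Compl p) (auto simp: numeral_3_eq_3)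
    from l obtain S where S: "cayley_subset p S" "l = covalency p S"
      and all: "\<And>S. cayley_subset p S \<Longrightarrow> covalency p S \<le> l \<Longrightarrow> ramanujan p S"
      by (auto simp: good_covalencies_def)
    have "odd l" using odd_covalency[OF S(1) p(2)] S(2) by simp
    then have "l \<noteq> 2 * r + 2" by auto
    then have "covalency p ?S \<le> l"
      using cayley_subset_central_Compl(2)[OF p(1), of "Suc r"] r \<open>\<not> l \<le> 2 * r + 1\<close> by simp
    then show False
      using all not_ram cayley_subset_central_Compl(1)[OF p(1), of "Suc r"] r by simp
  qed
qed

section \<open>Primes of the form \<open>k\<^sup>2 + 5k + c\<close>\<close>

text \<open>Instance r = k + 1 of \<open>l_hat_eqI\<close>. The condition with 17 is the squared
  lower bound required there; \<open>c \<le> 5\<close>, being below 25/4, keeps the floor in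
  \<open>l_zero\<close> at k.\<close>

lemma exceptionalI:
  fixes p k :: nat and c :: int
  assumes p: "prime p" "odd p" "int p = int k ^ 2 + 5 * int k + c"
    and k: "2 \<le> k" "17 \<le> 8 * int k + 4 * c" "c \<le> 5"
    and upper: "sin ((2 * real k + 3) * (pi / p)) \<le> sin (pi / p) * sqrt ((2 * real k + 3)\<^sup>2 - (25 - 4 * of_int c))"
    and gt: "sin (pi / p) * sqrt ((2 * real k + 3)\<^sup>2 - (33 - 4 * of_int c)) < sin ((2 * real k + 5) * (pi / p))"
  shows "exceptional p"
proof -
  have rp: "real p = (real k)\<^sup>2 + 5 * real k + of_int c"
    using arg_cong[OF p(3), of real_of_int] by simp
  have "2 * int k \<le> int k ^ 2" using k(1) by (simp add: power2_eq_square)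
  then have ip: "4 * int k + 4 \<le> int p" "2 * int k + 7 \<le> int p" "15 \<le> int p"
    using p(3) k by linarith+
  have rk: "17 \<le> 8 * real k + 4 * of_int c" "real_of_int c \<le> 5"
    using k by linarith+
  have two_sqrt: "2 * sqrt x = sqrt (4 * x)" for x by (simp add: real_sqrt_mult)
  have l_hat: "l_hat p = 2 * (k + 1) + 1"
  proof (rule l_hat_eqI[OF p(1,2)])
    show "4 * (k + 1) \<le> p" "2 * (k + 1) + 5 \<le> p" using ip by auto
    \<comment> \<open>For l = 2k + 3, 4 (p - l - 1) = l^2 - (25 - 4c); passing to l + 2 subtracts
      another 8.\<close>
    have R1: "2 * sqrt (real p - real (2 * (k + 1) + 1) - 1) = sqrt ((2 * real k + 3)\<^sup>2 - (25 - 4 * of_int c))"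
      unfolding two_sqrt by (simp add: rp power2_eq_square algebra_simps)
    have R2: "2 * sqrt (real p - real (2 * (k + 1) + 3) - 1) = sqrt ((2 * real k + 3)\<^sup>2 - (33 - 4 * of_int c))"
      unfolding two_sqrt by (simp add: rp power2_eq_square algebra_simps)
    show "sin (real (2 * (k + 1) + 1) * (pi / p)) \<le> sin (pi / p) * (2 * sqrt (real p - real (2 * (k + 1) + 1) - 1))"
      unfolding R1 using upper by (simp add: add.commute)
    show "sin (pi / p) * (2 * sqrt (real p - real (2 * (k + 1) + 3) - 1)) < sin (real (2 * (k + 1) + 3) * (pi / p))"
      unfolding R2 using gt by (simp add: add.commute)
    have "(real (2 * (k + 1) + 1) - 2)\<^sup>2 \<le> (2 * real k + 3)\<^sup>2 - (25 - 4 * of_int c)"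
      using rk by (simp add: power2_eq_square algebra_simps)
    then show "real (2 * (k + 1) + 1) - 2 \<le> 2 * sqrt (real p - real (2 * (k + 1) + 1) - 1)"
      unfolding R1 by (rule real_le_rsqrt)
  qed
  have "(real k + 3 / 2)\<^sup>2 \<le> real p" "real p < (real k + 5 / 2)\<^sup>2"
    using rk by (simp_all add: rp power2_eq_square field_simps)
  then have "real k + 3 / 2 \<le> sqrt (real p)" "sqrt (real p) < real k + 5 / 2"
    by (auto intro: real_le_rsqrt real_less_lsqrt)
  then have "\<lfloor>sqrt (real p) - 3 / 2\<rfloor> = int k" by (simp add: floor_eq_iff)
  then show ?thesis
    using p(2) ip l_hat by (simp add: exceptional_def l_zero_def)
qed

lemma sin_quotient_le_sqrt_cases:
  fixes k m :: real and c :: int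
  assumes m: "m = k\<^sup>2 + 5 * k + of_int c"
    and cases: "c = 5 \<and> 2 \<le> k \<or> c = 3 \<and> 2 \<le> k \<or> c = 1 \<and> 4 \<le> k \<or> c = - 1 \<and> 3 \<le> k \<or>
      c = - 3 \<and> 5 \<le> k \<or> c = - 5 \<and> 19 \<le> k"
  shows "sin ((2 * k + 3) * (pi / m)) \<le> sin (pi / m) * sqrt ((2 * k + 3)\<^sup>2 - (25 - 4 * of_int c))"
proof -
  have k_ge: "2 \<le> k" using cases by auto
  have mono: "a\<^sup>2 + 5 * a \<le> k\<^sup>2 + 5 * k" if "a \<le> k" "0 \<le> a" for a
    using that by (intro add_mono power_mono) auto
  \<comment> \<open>Tangent line of k^2 at a, which makes the quadratic conditions linear in
    k.\<close>
  have sq: "2 * a * k - a\<^sup>2 \<le> k\<^sup>2" for a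
    using zero_le_power2[of "k - a"] by (simp add: power2_diff mult_ac)
  have l2: "(2 * k + 3)\<^sup>2 = 4 * k\<^sup>2 + 12 * k + 9"
    by (simp add: power2_eq_square algebra_simps)
  have red: ?thesis
    if "1 \<le> l0" "l0 \<le> 2 * k + 3" "1 < m0" "m0 \<le> m" "0 \<le> u" "u * m \<le> 4 * k\<^sup>2 + 12 * k + 9" "4 * k\<^sup>2 + 12 * k + 9 \<le> 4 * m"
      "0 \<le> g" "g \<le> l0\<^sup>2" "g + 52 / m0 \<le> 1.6448 * u\<^sup>2 * (1 - 1 / l0\<^sup>2)"
      "25 - 4 * of_int c \<le> 2 * g - g\<^sup>2 / l0\<^sup>2" for l0 m0 u g
    using that by (intro sin_quotient_le_sqrt[of l0 _ m0 _ u g]) (auto simp: l2)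
  from cases consider "c = 5" "2 \<le> k" | "c = 3" "2 \<le> k" | "c = 1" "4 \<le> k" | "c = - 1" "3 \<le> k"
    | "c = - 3" "5 \<le> k" | "c = - 5" "19 \<le> k" by blast
  then show ?thesis
    \<comment> \<open>The third argument of \<open>red\<close> is a lower bound of \<open>(2k + 3)\<^sup>2 / m\<close>; where this quotient is not
      monotone in \<open>k\<close>, \<open>sq\<close> is applied at the vertex of the resulting quadratic polynomial.\<close>
  proof cases
    case 1
    with m k_ge mono[of 2] sq[of 2] show ?thesis
      by (intro red[of 7 19 "2.5" 4]) (simp_all add: field_simps)
  next
    case 2
    with m k_ge mono[of 2] sq[of 2] show ?thesis
      by (intro red[of 7 17 "2.8" 8]) (simp_all add: field_simps)
  next
    case 3
    with m k_ge mono[of 4] sq[of "5 / 2"] show ?thesis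
      by (intro red[of 11 37 "3.2" 12]) (simp_all add: field_simps)
  next
    case 4
    with m k_ge mono[of 3] sq[of "5235 / 1106"] show ?thesis
      by (intro red[of 9 23 "3.447" "16.5"]) (simp_all add: field_simps)
  next
    case 5
    with m k_ge mono[of 5] sq[of "5835 / 866"] show ?thesis
      by (intro red[of 13 47 "3.567" "19.67"]) (simp_all add: field_simps)
  next
    case 6
    with m k_ge mono[of 19] sq[of 19] show ?thesis
      by (intro red[of 41 451 "3.727" "22.68"]) (simp_all add: field_simps)
  qed
qed

text \<open>With l = 2k + 5 the radicand is (l - 2)^2 - 2h, so the root is at most l - 2 - h / l and
  \<open>sin_quotient_gt\<close> applies.\<close>

lemma sin_quotient_gt_sqrt:
  fixes k m c :: real
  assumes m: "m = k\<^sup>2 + 5 * k + c" "33 \<le> m" and k: "4 \<le> k" and c: "- 5 \<le> c" "c \<le> 5"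
  shows "sin (pi / m) * sqrt ((2 * k + 3)\<^sup>2 - (33 - 4 * c)) < sin ((2 * k + 5) * (pi / m))"
proof -
  define l d h where "l = 2 * k + 5" and "d = 25 - 4 * c" and "h = d / 2 + 4"
  have d: "0 \<le> d" "d \<le> 45" using c by (auto simp: d_def)
  have l: "13 \<le> l" using k by (simp add: l_def)
  have l2: "l\<^sup>2 = 4 * m + d" by (simp add: l_def d_def m power2_eq_square algebra_simps)
  have "13 * 11 \<le> l * (l - 2)" using l by (intro mult_mono) auto
  then have nonneg: "0 \<le> l - 2 - h / l" using l d by (simp add: h_def field_simps)
  have "(l - 2 - h / l)\<^sup>2 = (l - 2)\<^sup>2 - 2 * h + 4 * h / l + (h / l)\<^sup>2"
    using l by (simp add: power2_eq_square field_simps)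
  moreover have "0 \<le> 4 * h / l" using l d by (simp add: h_def)
  moreover have "(2 * k + 3)\<^sup>2 - (33 - 4 * c) = (l - 2)\<^sup>2 - 2 * h"
    by (simp add: l_def h_def d_def power2_eq_square field_simps)
  ultimately have "(2 * k + 3)\<^sup>2 - (33 - 4 * c) \<le> (l - 2 - h / l)\<^sup>2"
    using zero_le_power2[of "h / l"] by linarith
  then have R: "sqrt ((2 * k + 3)\<^sup>2 - (33 - 4 * c)) \<le> l - 2 - h / l"
    using nonneg by (simp add: real_le_lsqrt)
  have m_pos: "0 < m" using m(2) by simp
  have "9.87 * l ^ 4 = 9.87 * (l\<^sup>2)\<^sup>2" by simp
  also have "\<dots> \<le> 9.87 * (m * (4 + d / 33))\<^sup>2"
  proof -
    have "d * 33 \<le> d * m" using m(2) d by (intro mult_left_mono) auto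
    then have "l\<^sup>2 \<le> m * (4 + d / 33)" by (simp add: l2 field_simps)
    then show ?thesis by (intro mult_left_mono power_mono) auto
  qed
  also have "\<dots> = m\<^sup>2 * (9.87 * (4 + d / 33)\<^sup>2)" by (simp add: power_mult_distrib)
  \<comment> \<open>180 + 3d is the value of 6 (2l + h) at l = 13, as 6h = 3d + 24.\<close>
  also have "\<dots> < m\<^sup>2 * (180 + 3 * d)"
  proof (rule mult_strict_left_mono)
    have "d * d \<le> 45 * d" using d by (intro mult_right_mono) auto
    then show "9.87 * (4 + d / 33)\<^sup>2 < 180 + 3 * d"
      using d by (simp add: power2_eq_square field_simps)
  qed (use m_pos in simp)
  also have "\<dots> \<le> m\<^sup>2 * (6 * (2 * l + h))"
    using l by (intro mult_left_mono) (auto simp: h_def)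
  also have "\<dots> = 6 * m\<^sup>2 * (2 * l + h)" by simp
  finally have "9.87 * l ^ 4 < 6 * m\<^sup>2 * (2 * l + h)" .
  moreover have "0 \<le> (2 * k + 3)\<^sup>2 - (33 - 4 * c)"
  proof -
    have "11\<^sup>2 \<le> (2 * k + 3)\<^sup>2" using k by (intro power_mono) auto
    then show ?thesis using c by simp
  qed
  ultimately show ?thesis
    using sin_quotient_gt[of l m _ h] l R m(2) by (simp add: l_def)
qed

text \<open>Half-angle formula 1 - cos x = 2 sin^2 (x/2).\<close>

lemma cos_ge_quadratic: "1 - x\<^sup>2 / 2 \<le> cos x" for x :: real
proof -
  have "\<bar>sin (x / 2)\<bar>\<^sup>2 \<le> \<bar>x / 2\<bar>\<^sup>2"
    by (intro power_mono abs_sin_x_le_abs_x) auto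
  then have "(sin (x / 2))\<^sup>2 \<le> x\<^sup>2 / 4" by (simp add: power_divide)
  then show ?thesis using cos_double_sin[of "x / 2"] by simp
qed

text \<open>For \<open>m = 17\<close> and \<open>m = 19\<close> the cubic bound for the sine is too weak, but the angle is close to \<open>\<pi>/2\<close>.\<close>

lemma sin_quotient_gt_17: "sin (pi / 17) * sqrt 28 < sin (9 * (pi / 17))"
proof -
  have "sin (pi / 17) * sqrt 28 \<le> (3.1416 / 17) * 5.3"
    using pi_approx sin_x_le_x[of "pi / 17"]
    by (intro mult_mono real_le_lsqrt) (auto simp: power2_eq_square)
  also have "\<dots> < 1 - (pi / 34)\<^sup>2 / 2"
    using pi_square_bounds by (simp add: power_divide)
  also have "\<dots> \<le> cos (pi / 34)" by (rule cos_ge_quadratic)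
  \<comment> \<open>9 pi / 17 exceeds pi / 2 by pi / 34.\<close>
  also have "\<dots> = sin (9 * (pi / 17))"
    by (simp add: sin_cos_eq cos_minus[of "pi / 34", symmetric] del: cos_minus)
  finally show ?thesis .
qed

lemma sin_quotient_gt_19: "sin (pi / 19) * sqrt 36 < sin (9 * (pi / 19))"
proof -
  have "sin (pi / 19) * sqrt 36 \<le> (3.1416 / 19) * 6"
    using pi_approx sin_x_le_x[of "pi / 19"]
    by (intro mult_mono real_le_lsqrt) (auto simp: power2_eq_square)
  also have "\<dots> < 1 - (pi / 38)\<^sup>2 / 2"
    using pi_square_bounds by (simp add: power_divide)
  also have "\<dots> \<le> cos (pi / 38)" by (rule cos_ge_quadratic)
  \<comment> \<open>9 pi / 19 falls short of pi / 2 by pi / 38.\<close>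
  also have "\<dots> = sin (9 * (pi / 19))"
    by (simp add: sin_cos_eq)
  finally show ?thesis .
qed

lemma sin_quotient_gt_23: "sin (pi / 23) * sqrt 44 < sin (11 * (pi / 23))"
proof -
  \<comment> \<open>73/11 is l - 2 - h / l for l = 11 and h = 26.\<close>
  have "sqrt 44 \<le> 73 / 11" by (rule real_le_lsqrt) (auto simp: power2_eq_square)
  then show ?thesis by (intro sin_quotient_gt[where h = 26]) auto
qed

lemma sin_quotient_gt_29: "sin (pi / 29) * sqrt 68 < sin (11 * (pi / 29))"
proof -
  \<comment> \<open>454/55 is l - 2 - h / l for l = 11 and h = 41/5.\<close>
  have "sqrt 68 \<le> 454 / 55" by (rule real_le_lsqrt) (auto simp: power2_eq_square)
  then show ?thesis by (intro sin_quotient_gt[where h = "41 / 5"]) auto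
qed

theorem theorem4p3:
  fixes p :: nat
  assumes "prime p" and "odd p" and "p \<in> J"
  shows "exceptional p"
proof -
  have general: "exceptional p"
    if pc: "int p = int k ^ 2 + 5 * int k + c"
      and k: "4 \<le> k \<and> c \<in> {1, - 1, 3, - 3, 5} \<or> 19 \<le> k \<and> c = - 5" for k :: nat and c :: int
  proof (rule exceptionalI[OF assms(1,2) pc])
    have rp: "real p = (real k)\<^sup>2 + 5 * real k + of_int c"
      using arg_cong[OF pc, of real_of_int] by simp
    have k4: "4 \<le> k" using k by auto
    show "2 \<le> k" "17 \<le> 8 * int k + 4 * c" "c \<le> 5" using k by auto
    \<comment> \<open>For c = -3 the upper estimate starts at k = 5; k = 4 would give the composite
      33.\<close>
    have "p \<noteq> 33"
    proof
      assume "p = 33"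
      then show False using assms(1) by simp
    qed
    then have "\<not> (c = - 3 \<and> k = 4)" using pc by auto
    then have "c = - 3 \<longrightarrow> 5 \<le> k" using k4 by auto
    then show "sin ((2 * real k + 3) * (pi / p)) \<le> sin (pi / p) * sqrt ((2 * real k + 3)\<^sup>2 - (25 - 4 * of_int c))"
      using k by (intro sin_quotient_le_sqrt_cases rp) auto
    \<comment> \<open>k = 4 gives 36 + c, which is at least 33 unless c = -5; there 19 \<le> k is
      used.\<close>
    have "4\<^sup>2 + 5 * 4 \<le> (real k)\<^sup>2 + 5 * real k" using k4 by (intro add_mono power_mono) auto
    moreover have "19\<^sup>2 + 5 * 19 \<le> (real k)\<^sup>2 + 5 * real k" if "c = - 5"
      using k that by (intro add_mono power_mono) auto
    ultimately have "33 \<le> real p" using k rp by auto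
    then show "sin (pi / p) * sqrt ((2 * real k + 3)\<^sup>2 - (33 - 4 * of_int c)) < sin ((2 * real k + 5) * (pi / p))"
      using k k4 by (intro sin_quotient_gt_sqrt rp) auto
  qed
  from assms(3) consider n where "p = 2 * n + 1" "7 \<le> n" "n \<le> 14"
    | k c where "4 \<le> k" "c \<in> {1, - 1, 3, - 3, 5}" "int p = int k ^ 2 + 5 * int k + c"
    | k where "19 \<le> k" "int p = int k ^ 2 + 5 * int k - 5"
    by (auto simp: J_def)
  then show ?thesis
  proof cases
    case 1
    then have "n \<in> {7, 8, 9, 10, 11, 12, 13, 14}" by auto
    then have "p \<in> {15, 17, 19, 21, 23, 25, 27, 29}" using 1 by auto
    moreover have "p \<noteq> 15" "p \<noteq> 21" "p \<noteq> 25" "p \<noteq> 27" using assms(1) by auto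
    \<comment> \<open>These primes have k < 4, outside the range of
      \<open>sin_quotient_gt_sqrt\<close>, so each has its own strict estimate.\<close>
    ultimately consider "p = 17" | "p = 19" | "p = 23" | "p = 29" by blast
    then show ?thesis
    proof cases
      case 1
      then show ?thesis
        using assms sin_quotient_le_sqrt_cases[of 17 2 3] sin_quotient_gt_17
        by (intro exceptionalI[of p 2 3]) auto
    next
      case 2
      then show ?thesis
        using assms sin_quotient_le_sqrt_cases[of 19 2 5] sin_quotient_gt_19
        by (intro exceptionalI[of p 2 5]) auto
    next
      case 3
      then show ?thesis
        using assms sin_quotient_le_sqrt_cases[of 23 3 "- 1"] sin_quotient_gt_23
        by (intro exceptionalI[of p 3 "- 1"]) auto
    next
      case 4
      then show ?thesis
        using assms sin_quotient_le_sqrt_cases[of 29 3 5] sin_quotient_gt_29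
        by (intro exceptionalI[of p 3 5]) auto
    qed
  next
    case 2
    then show ?thesis using general by blast
  next
    case (3 k)
    then show ?thesis using general[of k "- 5"] by simp
  qed
qed

end
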